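(* Let $\delta\ge1$ be an integer and $n\ge0$. For every $k$ that is the degree of some vertex of $\mathcal{W}_n$, the global weighted average degree of the nearest neighbors for vertices with degree $k$ in $\mathcal{W}_n$ is $$\begin{aligned}k_{\rm nn}^w(k)&= \frac{\left(\frac{k(\delta+1)}{2}-\delta\right)^{\frac{\ln(\delta+1)}{\ln(\delta+2)}}}{\delta+1} +\frac{2\left(\frac{\left(\frac{k(\delta+1)}{2}-\delta\right)^{\frac{\ln(\delta+1)}{\ln(\delta+2)}}}{\delta+1}+\delta^2+\delta-1\right)}{\delta(\delta+2)}\\ &\quad-\frac{2(\delta+2)\left(\frac{k(\delta+1)}{2}-\delta\right)^{\frac{\ln(\delta+1)}{\ln(\delta+2)}}}{\delta(\delta+3)(\delta+1)} +\frac{(\delta+2)^{2n}\left(\frac{k(\delta+1)}{2}-\delta\right)^{\frac{\ln[(\delta+4)(\delta+1)]}{\ln(\delta+2)}-2}}{\delta(\delta+3)(\delta+4)^{n-1}}.\end{aligned}$$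
   Context: The degree $k_j$ of a vertex $j$ is its number of neighbors; the strength of a vertex $i$ in a weighted graph is $s_i=\sum_j w_{ij}$, the sum of the weights of its incident edges ($w_{ij}=0$ if $i,j$ are not adjacent). The weighted average nearest-neighbor degree of a vertex $i$ is $\frac{1}{s_i}\sum_{j}w_{ij}k_j$, and $k_{\rm nn}^w(k)$ is the average of this quantity over all vertices $i$ of degree $k$. The weighted graphs $\mathcal{W}_n$ ($n\ge 0$) are defined recursively for a fixed integer $\delta\ge1$. $\mathcal{W}_0$ is a triangle whose three edges have weight $1$. For $n\ge1$, $\mathcal{W}_n$ is obtained from $\mathcal{W}_{n-1}$ as follows: (I) for each vertex $i$ of $\mathcal{W}_{n-1}$, of strength $s_i$ in $\mathcal{W}_{n-1}$ (always an even integer), take $s_i/2$ new disjoint copies of $\mathcal{K}_2$ (two vertices joined by an edge of weight $1$) and join both vertices of each copy to $i$ by edges of weight $1$; (II) multiply the weight of every edge that already belonged to $\mathcal{W}_{n-1}$ by $1+\delta$. *)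

theory Defs
  imports Complex_Main
begin

text \<open>
  Finite simple graphs with edge weights. Edges are two-element sets of vertices; the value of
  \<open>edge_weight\<close> matters only on edges. All weights occurring here are natural numbers.
\<close>

record 'a weighted_graph =
  verts :: "'a set"
  edges :: "'a set set"
  edge_weight :: "'a set \<Rightarrow> nat"

definition adj_weight :: "'a weighted_graph \<Rightarrow> 'a \<Rightarrow> 'a \<Rightarrow> nat" where
  "adj_weight G i j = (if {i, j} \<in> edges G then edge_weight G {i, j} else 0)"

definition degree :: "'a weighted_graph \<Rightarrow> 'a \<Rightarrow> nat" where
  "degree G i = card {j \<in> verts G. {i, j} \<in> edges G}"

definition strength :: "'a weighted_graph \<Rightarrow> 'a \<Rightarrow> nat" where
  "strength G i = (\<Sum>j\<in>verts G. adj_weight G i j)"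

definition weighted_nn_degree :: "'a weighted_graph \<Rightarrow> 'a \<Rightarrow> real" where
  "weighted_nn_degree G i =
     (1 / real (strength G i)) * (\<Sum>j\<in>verts G. real (adj_weight G i j) * real (degree G j))"

definition verts_of_degree :: "'a weighted_graph \<Rightarrow> nat \<Rightarrow> 'a set" where
  "verts_of_degree G k = {i \<in> verts G. degree G i = k}"

definition knn_w :: "'a weighted_graph \<Rightarrow> nat \<Rightarrow> real" where
  "knn_w G k =
     (\<Sum>i\<in>verts_of_degree G k. weighted_nn_degree G i) / real (card (verts_of_degree G k))"

text \<open>
  Concrete vertex names. \<open>Born n i c b\<close> is one of the two vertices (selected by \<open>b\<close>) of the
  \<open>c\<close>-th copy of \<open>K\<^sub>2\<close> attached to vertex \<open>i\<close> in step \<open>n\<close>. Recording the step makes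
  the vertices added in different steps distinct.
\<close>

datatype vertex = Root nat | Born nat vertex nat bool

definition triangle :: "vertex weighted_graph" where
  "triangle =
     \<lparr> verts = {Root 0, Root 1, Root 2},
       edges = {{Root 0, Root 1}, {Root 0, Root 2}, {Root 1, Root 2}},
       edge_weight = (\<lambda>e. 1) \<rparr>"

text \<open>
  One construction step. All strengths are even in the graphs to which it is applied, so that
  the truncating division by 2 is exact there.
\<close>

definition grow :: "nat \<Rightarrow> nat \<Rightarrow> vertex weighted_graph \<Rightarrow> vertex weighted_graph" where
  "grow \<delta> n G =
     \<lparr> verts = verts G \<union>
         {Born n i c b | i c b. i \<in> verts G \<and> c < strength G i div 2},
       edges = edges G \<union>
         {{Born n i c False, Born n i c True} | i c. i \<in> verts G \<and> c < strength G i div 2} \<union>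
         {{i, Born n i c b} | i c b. i \<in> verts G \<and> c < strength G i div 2},
       edge_weight = (\<lambda>e. if e \<in> edges G then (1 + \<delta>) * edge_weight G e else 1) \<rparr>"

fun W :: "nat \<Rightarrow> nat \<Rightarrow> vertex weighted_graph" where
  "W \<delta> 0 = triangle"
| "W \<delta> (Suc n) = grow \<delta> (Suc n) (W \<delta> n)"

end

theory Submission
  imports Defs
begin

text \<open>
  A vertex of age \<open>a\<close> has strength \<open>2 (\<delta> + 2)\<^sup>a\<close>, and throughout \<open>(\<delta> + 1) k\<^sub>i = s\<^sub>i + 2 \<delta>\<close>.
  So the degree determines the age, and the average of the neighbours' degrees is an affine function
  of the weighted average \<open>u\<^sub>i\<close> of the neighbours' strengths. In a growth step the latter changes by
  \<open>u \<mapsto> (\<delta> + 1) u + 2 / (\<delta> + 2)\<close>, the same affine map for every old vertex; hence only the mean of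
  \<open>u\<close> over the vertices born in step \<open>m\<close>, at the time of their birth, is needed. As a vertex \<open>i\<close> has
  \<open>s\<^sub>i\<close> children, each with \<open>u = ((\<delta> + 2) s\<^sub>i + 2) / 2\<close>, that mean is governed by \<open>\<Sum>s\<^sub>i\<close> and \<open>\<Sum>s\<^sub>i\<^sup>2\<close>,
  which satisfy linear recurrences.
\<close>

section \<open>One growth step\<close>

text \<open>Grouping the new vertices by parent lets sums over the enlarged graph split into an old
  part and one finite sum per parent.\<close>

definition offspring :: "nat \<Rightarrow> vertex weighted_graph \<Rightarrow> vertex \<Rightarrow> vertex set" where
  "offspring n G i = {Born n i c b | c b. c < strength G i div 2}"

text \<open>With \<open>f\<close> constantly 1 this is the strength, with \<open>f\<close> the
  degree the numerator of the weighted nearest-neighbor degree; one growth recursion serves every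
  \<open>f\<close>.\<close>

definition neighbour_sum :: "'a weighted_graph \<Rightarrow> ('a \<Rightarrow> real) \<Rightarrow> 'a \<Rightarrow> real" where
  "neighbour_sum G f i = (\<Sum>j\<in>verts G. real (adj_weight G i j) * f j)"

definition wf_graph :: "'a weighted_graph \<Rightarrow> bool" where
  "wf_graph G \<longleftrightarrow> finite (verts G) \<and> (\<forall>e\<in>edges G. e \<subseteq> verts G)"

fun birth :: "vertex \<Rightarrow> nat" where
  "birth (Root r) = 0"
| "birth (Born n i c b) = n"

lemma strength_eq_neighbour_sum: "real (strength G i) = neighbour_sum G (\<lambda>_. 1) i"
  by (simp add: strength_def neighbour_sum_def)

lemma offspring_eq_image:
  "offspring n G i = (\<lambda>(c, b). Born n i c b) ` ({..<strength G i div 2} \<times> UNIV)"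
  by (auto simp: offspring_def)

lemma finite_offspring [simp]: "finite (offspring n G i)"
  by (simp add: offspring_eq_image)

lemma sum_offspring:
  "sum f (offspring n G i) =
    (\<Sum>c<strength G i div 2. f (Born n i c False) + f (Born n i c True))"
proof -
  have "inj_on (\<lambda>(c, b). Born n i c b) ({..<strength G i div 2} \<times> UNIV)"
    by (auto simp: inj_on_def)
  then have "sum f (offspring n G i) =
      (\<Sum>(c, b)\<in>{..<strength G i div 2} \<times> UNIV. f (Born n i c b))"
    by (simp add: offspring_eq_image sum.reindex case_prod_unfold)
  also have "\<dots> = (\<Sum>c<strength G i div 2. \<Sum>b\<in>UNIV. f (Born n i c b))"
    by (rule sum.cartesian_product [symmetric])
  finally show ?thesis
    by (simp add: UNIV_bool)
qed

lemma card_offspring: "card (offspring n G i) = 2 * (strength G i div 2)"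
  using sum_offspring [of "\<lambda>_. 1::nat" n G i] by simp

lemma verts_grow: "verts (grow \<delta> n G) = verts G \<union> (\<Union>i\<in>verts G. offspring n G i)"
  by (auto simp: grow_def offspring_def)

text \<open>Freshness separates new vertices from old ones; since \<open>wf\<close> keeps the old
  edges inside \<open>verts G\<close>, no old edge can touch a new vertex.\<close>

locale fresh_step =
  fixes n :: nat and G :: "vertex weighted_graph"
  assumes wf: "wf_graph G"
    and fresh: "\<And>i c b. Born n i c b \<notin> verts G"
begin

lemma finite_verts [simp]: "finite (verts G)"
  using wf by (simp add: wf_graph_def)

lemma edge_subset: "e \<in> edges G \<Longrightarrow> v \<in> e \<Longrightarrow> v \<in> verts G"
  using wf by (auto simp: wf_graph_def)

lemma wf_grow: "wf_graph (grow \<delta> n G)"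
  unfolding wf_graph_def
proof
  show "finite (verts (grow \<delta> n G))"
    by (simp add: verts_grow)
  show "\<forall>e\<in>edges (grow \<delta> n G). e \<subseteq> verts (grow \<delta> n G)"
    using edge_subset by (auto simp: grow_def)
qed

lemma verts_offspring_disjoint: "verts G \<inter> (\<Union>i\<in>verts G. offspring n G i) = {}"
  using fresh by (auto simp: offspring_def)

lemma sum_verts_grow:
  "sum f (verts (grow \<delta> n G)) = sum f (verts G) + (\<Sum>i\<in>verts G. sum f (offspring n G i))"
proof -
  have "sum f (\<Union>i\<in>verts G. offspring n G i) = (\<Sum>i\<in>verts G. sum f (offspring n G i))"
    by (rule sum.UNION_disjoint) (simp_all, auto simp: offspring_def)
  then show ?thesis
    by (simp add: verts_grow sum.union_disjoint verts_offspring_disjoint)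
qed

lemma old_edge_grow:
  assumes "i \<in> verts G" "j \<in> verts G"
  shows "{i, j} \<in> edges (grow \<delta> n G) \<longleftrightarrow> {i, j} \<in> edges G"
  using assms fresh by (auto simp: grow_def doubleton_eq_iff)

text \<open>A fresh \<open>j\<close> lies on no old edge, and its partner in the K2 copy is fresh
  too, so its only edge to an old vertex leads to the parent recorded in its name.\<close>

lemma old_new_edge_grow:
  assumes "i \<in> verts G" "p \<in> verts G" "j \<in> offspring n G p"
  shows "{i, j} \<in> edges (grow \<delta> n G) \<longleftrightarrow> i = p"
  using assms fresh edge_subset [of "{i, j}" j]
  by (fastforce simp: grow_def offspring_def doubleton_eq_iff)

text \<open>Attachment edges have an old endpoint and old edges contain no fresh vertex, which
  leaves only the edge inside a K2 copy.\<close>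

lemma new_new_edge_grow:
  assumes "p \<in> verts G" "c < strength G p div 2" "q \<in> verts G" "c' < strength G q div 2"
  shows "{Born n p c b, Born n q c' b'} \<in> edges (grow \<delta> n G) \<longleftrightarrow>
    Born n q c' b' = Born n p c (\<not> b)"
proof -
  have "{Born n p c b, Born n q c' b'} \<notin> edges G"
    using edge_subset fresh by blast
  moreover have "{Born n p c b, Born n q c' b'} \<noteq> {i, Born n i d a}" if "i \<in> verts G" for i d a
    using that fresh by (auto simp: doubleton_eq_iff)
  ultimately show ?thesis
    using assms by (auto simp: grow_def doubleton_eq_iff)
qed

lemma edge_weight_grow:
  "edge_weight (grow \<delta> n G) e = (if e \<in> edges G then (1 + \<delta>) * edge_weight G e else 1)"
  by (simp add: grow_def)

lemma new_edge_not_old: "j \<in> offspring n G p \<Longrightarrow> {i, j} \<notin> edges G"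
  using edge_subset [of "{i, j}" j] fresh by (auto simp: offspring_def)

lemma adj_weight_grow_old:
  assumes "i \<in> verts G" "j \<in> verts G"
  shows "adj_weight (grow \<delta> n G) i j = (1 + \<delta>) * adj_weight G i j"
  using assms by (simp add: adj_weight_def old_edge_grow edge_weight_grow)

lemma adj_weight_grow_old_new:
  assumes "i \<in> verts G" "p \<in> verts G" "j \<in> offspring n G p"
  shows "adj_weight (grow \<delta> n G) i j = (if i = p then 1 else 0)"
  using assms by (simp add: adj_weight_def old_new_edge_grow edge_weight_grow new_edge_not_old)

text \<open>Old edges at \<open>i\<close> are scaled by \<open>1 + \<delta>\<close>; the new ones
  have weight 1 and end in its own offspring. The later recursions for strengths and neighbour
  averages at old vertices come from this.\<close>

lemma neighbour_sum_grow_old: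
  assumes "i \<in> verts G"
  shows "neighbour_sum (grow \<delta> n G) f i =
    (1 + real \<delta>) * neighbour_sum G f i + sum f (offspring n G i)"
proof -
  have "(\<Sum>j\<in>verts G. real (adj_weight (grow \<delta> n G) i j) * f j) =
      (1 + real \<delta>) * neighbour_sum G f i"
    using assms by (simp add: adj_weight_grow_old neighbour_sum_def sum_distrib_left algebra_simps)
  moreover have "(\<Sum>p\<in>verts G. \<Sum>j\<in>offspring n G p. real (adj_weight (grow \<delta> n G) i j) * f j) =
      (\<Sum>p\<in>verts G. if i = p then sum f (offspring n G p) else 0)"
    using assms by (intro sum.cong) (auto simp: adj_weight_grow_old_new)
  ultimately show ?thesis
    using assms by (simp add: neighbour_sum_def [of "grow \<delta> n G"] sum_verts_grow)
qed

lemma neighbours_grow_old: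
  assumes "i \<in> verts G"
  shows "{j \<in> verts (grow \<delta> n G). {i, j} \<in> edges (grow \<delta> n G)} =
    {j \<in> verts G. {i, j} \<in> edges G} \<union> offspring n G i"
proof -
  have "{j \<in> verts G. {i, j} \<in> edges (grow \<delta> n G)} = {j \<in> verts G. {i, j} \<in> edges G}"
    using assms old_edge_grow by blast
  moreover have "{j \<in> offspring n G p. {i, j} \<in> edges (grow \<delta> n G)} =
      (if i = p then offspring n G p else {})" if "p \<in> verts G" for p
    by (simp add: old_new_edge_grow [OF assms that] Collect_conv_if cong: conj_cong)
  moreover have "{j \<in> verts (grow \<delta> n G). {i, j} \<in> edges (grow \<delta> n G)} =
      {j \<in> verts G. {i, j} \<in> edges (grow \<delta> n G)} \<union>
      (\<Union>p\<in>verts G. {j \<in> offspring n G p. {i, j} \<in> edges (grow \<delta> n G)})"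
    unfolding verts_grow by blast
  ultimately show ?thesis
    using assms by simp
qed

lemma neighbours_grow_new:
  assumes "p \<in> verts G" "c < strength G p div 2"
  shows "{j \<in> verts (grow \<delta> n G). {Born n p c b, j} \<in> edges (grow \<delta> n G)} =
    {p, Born n p c (\<not> b)}" (is "?N = _")
proof -
  have off: "Born n p c a \<in> offspring n G p" for a
    using assms by (auto simp: offspring_def)
  show ?thesis
  proof (rule set_eqI)
    fix j
    consider "j \<in> verts G" | q where "q \<in> verts G" "j \<in> offspring n G q"
      | "j \<notin> verts (grow \<delta> n G)"
      by (auto simp: verts_grow)
    then show "j \<in> ?N \<longleftrightarrow> j \<in> {p, Born n p c (\<not> b)}"
    proof cases
      case 1
      then have "j \<noteq> Born n p c (\<not> b)"
        using fresh by metis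
      moreover have "{Born n p c b, j} = {j, Born n p c b}"
        by blast
      ultimately show ?thesis
        using 1 by (simp add: old_new_edge_grow [OF 1 assms(1) off] verts_grow)
    next
      case 2
      then obtain c' b' where "c' < strength G q div 2" "j = Born n q c' b'"
        by (auto simp: offspring_def)
      moreover have "j \<in> verts (grow \<delta> n G)"
        using 2 by (auto simp: verts_grow)
      moreover have "j \<noteq> p"
        using calculation(2) assms(1) fresh by metis
      ultimately show ?thesis
        using new_new_edge_grow [OF assms 2(1)] by simp
    next
      case 3
      then have "j \<noteq> p" "j \<noteq> Born n p c (\<not> b)"
        using assms(1) off by (auto simp: verts_grow)
      with 3 show ?thesis
        by simp
    qed
  qed
qed

lemma degree_grow_old:
  assumes "i \<in> verts G"
  shows "degree (grow \<delta> n G) i = degree G i + 2 * (strength G i div 2)"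
proof -
  have "{j \<in> verts G. {i, j} \<in> edges G} \<inter> offspring n G i = {}"
    using fresh by (auto simp: offspring_def)
  then show ?thesis
    using assms by (simp add: degree_def neighbours_grow_old card_Un_disjoint card_offspring)
qed

lemma degree_grow_new:
  assumes "p \<in> verts G" "c < strength G p div 2"
  shows "degree (grow \<delta> n G) (Born n p c b) = 2"
proof -
  have "p \<noteq> Born n p c (\<not> b)"
    using assms fresh by metis
  then show ?thesis
    using assms by (simp add: degree_def neighbours_grow_new)
qed

lemma neighbour_sum_grow_new:
  assumes "p \<in> verts G" "c < strength G p div 2"
  shows "neighbour_sum (grow \<delta> n G) f (Born n p c b) = f p + f (Born n p c (\<not> b))"
proof -
  have off: "Born n p c b \<in> offspring n G p"
    using assms by (auto simp: offspring_def)
  have ne: "p \<noteq> Born n p c (\<not> b)"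
    using assms fresh by metis
  \<comment> \<open>All edges at a new vertex are new, hence of weight 1, so the weighted sum
    becomes a plain sum over its two neighbours.\<close>
  have "{Born n p c b, j} \<notin> edges G" for j
    using new_edge_not_old [OF off, of j] by (simp add: insert_commute)
  then have "neighbour_sum (grow \<delta> n G) f (Born n p c b) =
      (\<Sum>j\<in>verts (grow \<delta> n G). if {Born n p c b, j} \<in> edges (grow \<delta> n G) then f j else 0)"
    by (auto simp: neighbour_sum_def adj_weight_def edge_weight_grow intro!: sum.cong)
  also have "\<dots> = sum f {j \<in> verts (grow \<delta> n G). {Born n p c b, j} \<in> edges (grow \<delta> n G)}"
    using wf_grow by (simp add: sum.inter_filter wf_graph_def)
  finally show ?thesis
    using assms ne by (simp add: neighbours_grow_new)
qed

text \<open>Reweighting turns \<open>s\<close> into \<open>(\<delta> + 1) * s\<close>, and by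
  evenness exactly \<open>s\<close> new edges of weight 1 are added.\<close>

lemma strength_grow_old:
  assumes "i \<in> verts G" "even (strength G i)"
  shows "strength (grow \<delta> n G) i = (\<delta> + 2) * strength G i"
proof -
  have "real (strength (grow \<delta> n G) i) = real ((\<delta> + 2) * strength G i)"
    using assms unfolding strength_eq_neighbour_sum [of "grow \<delta> n G"]
    by (simp add: neighbour_sum_grow_old card_offspring algebra_simps
        strength_eq_neighbour_sum [of G, symmetric] del: One_nat_def)
  then show ?thesis
    by (simp only: of_nat_eq_iff)
qed

lemma strength_grow_new:
  assumes "p \<in> verts G" "c < strength G p div 2"
  shows "strength (grow \<delta> n G) (Born n p c b) = 2"
proof -
  have "real (strength (grow \<delta> n G) (Born n p c b)) = real 2"
    using assms by (simp add: strength_eq_neighbour_sum neighbour_sum_grow_new)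
  then show ?thesis
    by (simp only: of_nat_eq_iff)
qed

end

section \<open>Strengths and degrees\<close>

lemma adj_weight_triangle:
  "i \<in> verts triangle \<Longrightarrow> j \<in> verts triangle \<Longrightarrow> adj_weight triangle i j = (if i = j then 0 else 1)"
  unfolding triangle_def adj_weight_def
  by (simp, elim disjE; simp add: doubleton_eq_iff)

lemma card_verts_triangle: "card (verts triangle) = 3"
  by (simp add: triangle_def)

lemma finite_verts_triangle: "finite (verts triangle)"
  by (simp add: triangle_def)

lemma neighbour_sum_triangle:
  assumes "i \<in> verts triangle"
  shows "neighbour_sum triangle (\<lambda>_. x) i = 2 * x"
proof -
  have "neighbour_sum triangle (\<lambda>_. x) i = (\<Sum>j\<in>verts triangle. if j \<in> verts triangle - {i} then x else 0)"
    using assms by (auto simp: neighbour_sum_def adj_weight_triangle intro!: sum.cong)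
  also have "\<dots> = real (card (verts triangle - {i})) * x"
    by (subst sum.inter_restrict [symmetric]) (simp_all add: finite_verts_triangle Int_absorb1)
  finally show ?thesis
    using assms by (simp add: card_Diff_singleton card_verts_triangle)
qed

lemma strength_triangle: "i \<in> verts triangle \<Longrightarrow> strength triangle i = 2"
  using neighbour_sum_triangle [of i 1] by (simp flip: strength_eq_neighbour_sum)

lemma degree_triangle:
  assumes "i \<in> verts triangle"
  shows "degree triangle i = 2"
proof -
  have "{j \<in> verts triangle. {i, j} \<in> edges triangle} = verts triangle - {i}"
    using assms by (auto simp: triangle_def doubleton_eq_iff)
  then show ?thesis
    using assms by (simp add: degree_def card_Diff_singleton card_verts_triangle)
qed

text \<open>The claims are proved jointly: the bound on births supplies the freshness required by
  \<open>fresh_step\<close>, and the form of the strength supplies the evenness behind the factor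
  \<open>\<delta> + 2\<close> per step. Roots and newborn vertices start at 2.\<close>

lemma W_invariant:
  "wf_graph (W \<delta> n) \<and>
    (\<forall>v\<in>verts (W \<delta> n). birth v \<le> n \<and> strength (W \<delta> n) v = 2 * (\<delta> + 2) ^ (n - birth v))"
proof (induction n)
  case 0
  have "wf_graph triangle" and "\<forall>v\<in>verts triangle. birth v = 0"
    by (auto simp: triangle_def wf_graph_def)
  then show ?case
    by (simp add: strength_triangle)
next
  case (Suc n)
  \<comment> \<open>Such a vertex would have birth \<open>Suc n\<close>, above the bound
    \<open>n\<close> of the induction hypothesis.\<close>
  have "Born (Suc n) i c b \<notin> verts (W \<delta> n)" for i c b
    using Suc by fastforce
  with Suc interpret fresh_step "Suc n" "W \<delta> n"
    by unfold_locales auto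
  have "birth v \<le> Suc n \<and> strength (W \<delta> (Suc n)) v = 2 * (\<delta> + 2) ^ (Suc n - birth v)"
    if "v \<in> verts (W \<delta> (Suc n))" for v
  proof (cases "v \<in> verts (W \<delta> n)")
    case True
    with Suc show ?thesis
      by (auto simp: strength_grow_old Suc_diff_le le_SucI)
  next
    case False
    with that obtain p c b where "p \<in> verts (W \<delta> n)" "c < strength (W \<delta> n) p div 2"
      "v = Born (Suc n) p c b"
      by (auto simp: verts_grow offspring_def)
    then show ?thesis
      by (simp add: strength_grow_new)
  qed
  with wf_grow show ?case
    by simp
qed

section \<open>Recurrences for strengths and degrees along the iteration\<close>

lemma birth_le: "v \<in> verts (W \<delta> n) \<Longrightarrow> birth v \<le> n"
  and strength_W: "v \<in> verts (W \<delta> n) \<Longrightarrow> strength (W \<delta> n) v = 2 * (\<delta> + 2) ^ (n - birth v)"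
  using W_invariant [of \<delta> n] by auto

interpretation step: fresh_step "Suc n" "W \<delta> n" for \<delta> n
proof
  show "wf_graph (W \<delta> n)"
    using W_invariant by blast
  show "Born (Suc n) i c b \<notin> verts (W \<delta> n)" for i c b
    using birth_le by fastforce
qed

lemma verts_W_Suc:
  "verts (W \<delta> (Suc n)) = verts (W \<delta> n) \<union> (\<Union>i\<in>verts (W \<delta> n). offspring (Suc n) (W \<delta> n) i)"
  by (simp add: verts_grow)

lemma sum_verts_W_Suc:
  "sum f (verts (W \<delta> (Suc n))) =
    sum f (verts (W \<delta> n)) + (\<Sum>i\<in>verts (W \<delta> n). sum f (offspring (Suc n) (W \<delta> n) i))"
  by (simp add: step.sum_verts_grow)

lemma strength_W_pos: "v \<in> verts (W \<delta> n) \<Longrightarrow> strength (W \<delta> n) v > 0"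
  by (simp add: strength_W)

lemma even_strength_W: "v \<in> verts (W \<delta> n) \<Longrightarrow> even (strength (W \<delta> n) v)"
  by (simp add: strength_W)

lemma card_offspring_W:
  "v \<in> verts (W \<delta> n) \<Longrightarrow> card (offspring m (W \<delta> n) v) = strength (W \<delta> n) v"
  by (simp add: card_offspring even_strength_W)

lemma strength_W_Suc:
  "v \<in> verts (W \<delta> n) \<Longrightarrow> strength (W \<delta> (Suc n)) v = (\<delta> + 2) * strength (W \<delta> n) v"
  by (simp add: step.strength_grow_old even_strength_W)

lemma strength_W_offspring:
  "p \<in> verts (W \<delta> n) \<Longrightarrow> v \<in> offspring (Suc n) (W \<delta> n) p \<Longrightarrow> strength (W \<delta> (Suc n)) v = 2"
  by (auto simp: offspring_def step.strength_grow_new)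

lemma degree_W_Suc:
  "v \<in> verts (W \<delta> n) \<Longrightarrow> degree (W \<delta> (Suc n)) v = degree (W \<delta> n) v + strength (W \<delta> n) v"
  by (simp add: step.degree_grow_old even_strength_W)

lemma degree_W_offspring:
  "p \<in> verts (W \<delta> n) \<Longrightarrow> v \<in> offspring (Suc n) (W \<delta> n) p \<Longrightarrow> degree (W \<delta> (Suc n)) v = 2"
  by (auto simp: offspring_def step.degree_grow_new)

declare W.simps(2) [simp del]

text \<open>In one step the degree of an old vertex grows by \<open>s\<close> and its strength by
  \<open>(\<delta> + 1) * s\<close>, so \<open>(\<delta> + 1) * k - s\<close> is conserved. At birth
  \<open>k = s = 2\<close>, which gives \<open>2 * \<delta>\<close>.\<close>

lemma degree_W:
  "v \<in> verts (W \<delta> n) \<Longrightarrow> (\<delta> + 1) * degree (W \<delta> n) v = strength (W \<delta> n) v + 2 * \<delta>"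
proof (induction n arbitrary: v)
  case 0
  then show ?case
    by (simp add: strength_triangle degree_triangle)
next
  case (Suc n)
  show ?case
  proof (cases "v \<in> verts (W \<delta> n)")
    case True
    have "(\<delta> + 1) * degree (W \<delta> (Suc n)) v =
        (\<delta> + 1) * degree (W \<delta> n) v + (\<delta> + 1) * strength (W \<delta> n) v"
      by (simp only: degree_W_Suc [OF True] distrib_left)
    also have "\<dots> = strength (W \<delta> (Suc n)) v + 2 * \<delta>"
      unfolding Suc.IH [OF True] strength_W_Suc [OF True] by simp
    finally show ?thesis .
  next
    case False
    with Suc.prems obtain p where "p \<in> verts (W \<delta> n)" "v \<in> offspring (Suc n) (W \<delta> n) p"
      by (auto simp: verts_W_Suc)
    then show ?thesis
      by (simp add: strength_W_offspring degree_W_offspring)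
  qed
qed

text \<open>A vertex of strength \<open>s\<close> passes on \<open>(\<delta> + 2) * s\<close> itself
  and \<open>2 * s\<close> through its \<open>s\<close> children, hence the factor
  \<open>\<delta> + 4\<close>; the triangle has total 6.\<close>

lemma sum_strength_W: "(\<Sum>v\<in>verts (W \<delta> n). real (strength (W \<delta> n) v)) = 6 * (real \<delta> + 4) ^ n"
proof (induction n)
  case 0
  then show ?case
    by (simp add: strength_triangle card_verts_triangle)
next
  case (Suc n)
  have "(\<Sum>v\<in>verts (W \<delta> (Suc n)). real (strength (W \<delta> (Suc n)) v)) =
      (\<Sum>v\<in>verts (W \<delta> n). (real \<delta> + 4) * real (strength (W \<delta> n) v))"
    by (simp add: sum_verts_W_Suc strength_W_Suc strength_W_offspring
        card_offspring_W algebra_simps flip: sum.distrib)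
  with Suc show ?case
    by (simp flip: sum_distrib_left)
qed

text \<open>The sum obeys \<open>S' = (\<delta> + 2)\<^sup>2 * S + 24 * (\<delta> + 4) ^ n\<close>.
  The difference of the two growth rates is \<open>\<delta> * (\<delta> + 3)\<close>, the
  denominator of the solution, here multiplied out.\<close>

lemma sum_strength_sq_W:
  "real \<delta> * (real \<delta> + 3) * (\<Sum>v\<in>verts (W \<delta> n). (real (strength (W \<delta> n) v))\<^sup>2) =
    12 * (real \<delta> + 1) * (real \<delta> + 2) * (real \<delta> + 2) ^ (2 * n) - 24 * (real \<delta> + 4) ^ n"
proof (induction n)
  case 0
  then show ?case
    by (simp add: strength_triangle card_verts_triangle algebra_simps)
next
  case (Suc n)
  define S where "S = (\<Sum>v\<in>verts (W \<delta> n). (real (strength (W \<delta> n) v))\<^sup>2)"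
  have "(\<Sum>v\<in>verts (W \<delta> (Suc n)). (real (strength (W \<delta> (Suc n)) v))\<^sup>2) =
      (\<Sum>v\<in>verts (W \<delta> n). (real \<delta> + 2)\<^sup>2 * (real (strength (W \<delta> n) v))\<^sup>2 + 4 * real (strength (W \<delta> n) v))"
    by (simp add: sum_verts_W_Suc strength_W_Suc strength_W_offspring
        card_offspring_W power2_eq_square algebra_simps flip: sum.distrib)
  also have "\<dots> = (real \<delta> + 2)\<^sup>2 * S + 24 * (real \<delta> + 4) ^ n"
    by (simp add: sum.distrib sum_strength_W S_def flip: sum_distrib_left)
  finally have *: "(\<Sum>v\<in>verts (W \<delta> (Suc n)). (real (strength (W \<delta> (Suc n)) v))\<^sup>2) =
      (real \<delta> + 2)\<^sup>2 * S + 24 * (real \<delta> + 4) ^ n" .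
  have "real \<delta> * (real \<delta> + 3) * ((real \<delta> + 2)\<^sup>2 * S + 24 * (real \<delta> + 4) ^ n) =
      (real \<delta> + 2)\<^sup>2 * (real \<delta> * (real \<delta> + 3) * S) + 24 * real \<delta> * (real \<delta> + 3) * (real \<delta> + 4) ^ n"
    by (simp add: algebra_simps)
  also have "\<dots> = (real \<delta> + 2)\<^sup>2 * (12 * (real \<delta> + 1) * (real \<delta> + 2) * (real \<delta> + 2) ^ (2 * n)
      - 24 * (real \<delta> + 4) ^ n) + 24 * real \<delta> * (real \<delta> + 3) * (real \<delta> + 4) ^ n"
    by (simp only: Suc S_def)
  \<comment> \<open>The terms in \<open>(\<delta> + 4) ^ n\<close> combine through \<open>(\<delta>
    + 2)\<^sup>2 - \<delta> * (\<delta> + 3) = \<delta> + 4\<close>.\<close>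
  also have "\<dots> = 12 * (real \<delta> + 1) * (real \<delta> + 2) * ((real \<delta> + 2)\<^sup>2 * (real \<delta> + 2) ^ (2 * n))
      - 24 * ((real \<delta> + 4) * (real \<delta> + 4) ^ n)"
    by algebra
  also have "(real \<delta> + 2)\<^sup>2 * (real \<delta> + 2) ^ (2 * n) = (real \<delta> + 2) ^ (2 * Suc n)"
    by (simp add: power2_eq_square)
  finally show ?case
    unfolding * by simp
qed

section \<open>Average strength of the neighbours\<close>

text \<open>The average \<open>u\<close> of the opening comment. Strengths are averaged instead of
  degrees because those of old vertices all scale by the same factor in a step.\<close>

definition nn_strength :: "nat \<Rightarrow> nat \<Rightarrow> vertex \<Rightarrow> real" where
  "nn_strength \<delta> n v =
    neighbour_sum (W \<delta> n) (\<lambda>j. real (strength (W \<delta> n) j)) v / real (strength (W \<delta> n) v)"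

section \<open>Cohorts of vertices born in the same step\<close>

definition cohort :: "nat \<Rightarrow> nat \<Rightarrow> vertex set" where
  "cohort \<delta> m = {v \<in> verts (W \<delta> m). birth v = m}"

lemma verts_W_mono: "verts (W \<delta> m) \<subseteq> verts (W \<delta> (m + a))"
  by (induction a) (auto simp: verts_W_Suc)

text \<open>Later steps only add vertices whose names carry a later step number, so a cohort is
  complete at birth.\<close>

lemma cohort_eq: "{v \<in> verts (W \<delta> (m + a)). birth v = m} = cohort \<delta> m"
proof (induction a)
  case 0
  then show ?case
    by (simp add: cohort_def)
next
  case (Suc a)
  have "birth v = Suc (m + a)" if "v \<in> offspring (Suc (m + a)) G p" for v G p
    using that by (auto simp: offspring_def)
  then have "{v \<in> verts (W \<delta> (m + Suc a)). birth v = m} = {v \<in> verts (W \<delta> (m + a)). birth v = m}"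
    by (fastforce simp: verts_W_Suc)
  with Suc show ?case
    by simp
qed

lemma cohort_0: "cohort \<delta> 0 = verts triangle"
  by (auto simp: cohort_def triangle_def)

lemma cohort_Suc: "cohort \<delta> (Suc m) = (\<Union>i\<in>verts (W \<delta> m). offspring (Suc m) (W \<delta> m) i)"
  using birth_le [of _ \<delta> m] by (fastforce simp: cohort_def verts_W_Suc offspring_def)

lemma sum_cohort_Suc:
  "sum f (cohort \<delta> (Suc m)) = (\<Sum>i\<in>verts (W \<delta> m). sum f (offspring (Suc m) (W \<delta> m) i))"
  unfolding cohort_Suc
  by (rule sum.UNION_disjoint) (simp_all, auto simp: offspring_def)

lemma neighbour_sum_W_Suc:
  "v \<in> verts (W \<delta> n) \<Longrightarrow> neighbour_sum (W \<delta> (Suc n)) f v =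
    (1 + real \<delta>) * neighbour_sum (W \<delta> n) f v + sum f (offspring (Suc n) (W \<delta> n) v)"
  by (simp add: W.simps(2) step.neighbour_sum_grow_old)

text \<open>The numerator becomes \<open>(1 + \<delta>) * (\<delta> + 2) * N + 2 * s\<close>, the
  last term from \<open>s\<close> children of strength 2. Dividing by the new strength
  \<open>(\<delta> + 2) * s\<close> removes the dependence on \<open>s\<close> from the additive
  term.\<close>

lemma nn_strength_Suc:
  assumes "v \<in> verts (W \<delta> n)"
  shows "nn_strength \<delta> (Suc n) v = (1 + real \<delta>) * nn_strength \<delta> n v + 2 / (real \<delta> + 2)"
proof -
  define s where "s = real (strength (W \<delta> n) v)"
  define N where "N = neighbour_sum (W \<delta> n) (\<lambda>j. real (strength (W \<delta> n) j)) v"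
  have "neighbour_sum (W \<delta> n) (\<lambda>j. real (strength (W \<delta> (Suc n)) j)) v = (real \<delta> + 2) * N"
    by (simp add: N_def neighbour_sum_def strength_W_Suc sum_distrib_left algebra_simps)
  moreover have "(\<Sum>j\<in>offspring (Suc n) (W \<delta> n) v. real (strength (W \<delta> (Suc n)) j)) = 2 * s"
    using assms by (simp add: strength_W_offspring card_offspring_W s_def)
  ultimately have "neighbour_sum (W \<delta> (Suc n)) (\<lambda>j. real (strength (W \<delta> (Suc n)) j)) v =
      (1 + real \<delta>) * ((real \<delta> + 2) * N) + 2 * s"
    using assms by (simp add: neighbour_sum_W_Suc)
  then have "nn_strength \<delta> (Suc n) v = ((1 + real \<delta>) * ((real \<delta> + 2) * N) + 2 * s) / ((real \<delta> + 2) * s)"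
    using assms by (simp add: nn_strength_def strength_W_Suc s_def algebra_simps)
  also have "\<dots> = (1 + real \<delta>) * (N / s) + 2 / (real \<delta> + 2)"
    using strength_W_pos [OF assms] by (simp add: s_def add_divide_distrib)
  finally show ?thesis
    by (simp add: nn_strength_def N_def s_def)
qed

text \<open>Iterating the affine map \<open>a\<close> times yields a geometric sum with ratio
  \<open>\<delta> + 1\<close>, whose denominator is the \<open>\<delta>\<close> in the second
  term.\<close>

lemma nn_strength_add:
  assumes "\<delta> \<ge> 1" "v \<in> verts (W \<delta> m)"
  shows "nn_strength \<delta> (m + a) v = (real \<delta> + 1) ^ a * nn_strength \<delta> m v
    + 2 * ((real \<delta> + 1) ^ a - 1) / (real \<delta> * (real \<delta> + 2))"
proof (induction a)
  case 0
  then show ?case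
    by simp
next
  case (Suc a)
  have "v \<in> verts (W \<delta> (m + a))"
    using assms(2) verts_W_mono by blast
  then have "nn_strength \<delta> (m + Suc a) v = (1 + real \<delta>) * ((real \<delta> + 1) ^ a * nn_strength \<delta> m v
      + 2 * ((real \<delta> + 1) ^ a - 1) / (real \<delta> * (real \<delta> + 2))) + 2 / (real \<delta> + 2)"
    by (simp add: nn_strength_Suc Suc)
  also have "\<dots> = (real \<delta> + 1) ^ Suc a * nn_strength \<delta> m v
      + 2 * ((real \<delta> + 1) ^ Suc a - 1) / (real \<delta> * (real \<delta> + 2))"
    using assms(1) by (simp add: divide_simps) (simp add: algebra_simps)
  finally show ?case .
qed

lemma nn_strength_triangle: "v \<in> verts triangle \<Longrightarrow> nn_strength \<delta> 0 v = 2"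
proof -
  assume v: "v \<in> verts triangle"
  have "neighbour_sum triangle (\<lambda>j. real (strength triangle j)) v = neighbour_sum triangle (\<lambda>_. 2) v"
    by (simp add: neighbour_sum_def strength_triangle)
  with v show ?thesis
    by (simp add: nn_strength_def neighbour_sum_triangle strength_triangle)
qed

text \<open>The two neighbours, joined by edges of weight 1, are the parent, already grown to
  \<open>\<delta> + 2\<close> times its old strength, and the sibling of strength 2.\<close>

lemma nn_strength_offspring:
  assumes "p \<in> verts (W \<delta> n)" "v \<in> offspring (Suc n) (W \<delta> n) p"
  shows "nn_strength \<delta> (Suc n) v = ((real \<delta> + 2) * real (strength (W \<delta> n) p) + 2) / 2"
proof -
  obtain c b where c: "c < strength (W \<delta> n) p div 2" and v: "v = Born (Suc n) p c b"
    using assms by (auto simp: offspring_def)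
  have "Born (Suc n) p c (\<not> b) \<in> offspring (Suc n) (W \<delta> n) p"
    using c by (auto simp: offspring_def)
  then have "neighbour_sum (W \<delta> (Suc n)) (\<lambda>j. real (strength (W \<delta> (Suc n)) j)) v =
      (real \<delta> + 2) * real (strength (W \<delta> n) p) + 2"
    using assms(1) c step.neighbour_sum_grow_new [OF assms(1) c, of \<delta>]
    by (simp add: v strength_W_Suc strength_W_offspring algebra_simps flip: W.simps(2))
  then show ?thesis
    using assms by (simp add: nn_strength_def strength_W_offspring)
qed

text \<open>
  The individual values of \<open>nn_strength\<close> in a cohort depend on the parent's strength; only their
  mean has a closed form.
\<close>

lemma sum_nn_strength_cohort:
  assumes "\<delta> \<ge> 1"
  shows "(\<Sum>v\<in>cohort \<delta> m. nn_strength \<delta> m v) = real (card (cohort \<delta> m)) *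
    ((real \<delta> + 1) * (real \<delta> + 4) * (real \<delta> + 2) ^ (2 * m)
        / (real \<delta> * (real \<delta> + 3) * (real \<delta> + 4) ^ m)
      + 1 - 2 * (real \<delta> + 2) / (real \<delta> * (real \<delta> + 3)))"
proof (cases m)
  case 0
  \<comment> \<open>Roots have no parent, so the triangle is checked directly: the formula must give
    its value 2.\<close>
  have eq_2: "(real \<delta> + 1) * (real \<delta> + 4) * (real \<delta> + 2) ^ (2 * 0)
        / (real \<delta> * (real \<delta> + 3) * (real \<delta> + 4) ^ 0) + 1
      - 2 * (real \<delta> + 2) / (real \<delta> * (real \<delta> + 3)) = 2"
    using assms by (simp add: divide_simps) (simp add: algebra_simps)
  show ?thesis
    unfolding 0 cohort_0 eq_2 by (simp add: nn_strength_triangle)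
next
  case (Suc t)
  define S where "S = (\<Sum>v\<in>verts (W \<delta> t). (real (strength (W \<delta> t) v))\<^sup>2)"
  define Q where "Q = (real \<delta> + 4) ^ t"
  define P where "P = (real \<delta> + 2) ^ (2 * t)"
  define D where "D = real \<delta> * (real \<delta> + 3)"
  have pos: "Q > 0" "D > 0"
    using assms by (simp_all add: Q_def D_def)
  have S: "S = (12 * (real \<delta> + 1) * (real \<delta> + 2) * P - 24 * Q) / D"
    using sum_strength_sq_W [of \<delta> t] pos(2) by (simp add: S_def P_def Q_def D_def field_simps)
  \<comment> \<open>Every vertex has as many children as its strength, so the cohort size is the
    total strength one step earlier.\<close>
  have "real (card (cohort \<delta> m)) = 6 * Q"
    using sum_cohort_Suc [of "\<lambda>_. 1::real" \<delta> t]
    by (simp add: Suc card_offspring_W sum_strength_W Q_def)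
  moreover have "(\<Sum>v\<in>cohort \<delta> m. nn_strength \<delta> m v) = (real \<delta> + 2) / 2 * S + 6 * Q"
  proof -
    \<comment> \<open>Vertex \<open>i\<close> contributes \<open>s\<close> children, each with value
      \<open>((\<delta> + 2) * s + 2) / 2\<close>; this is where the second moment enters.\<close>
    have "(\<Sum>v\<in>cohort \<delta> m. nn_strength \<delta> m v) = (\<Sum>i\<in>verts (W \<delta> t).
        (real \<delta> + 2) / 2 * (real (strength (W \<delta> t) i))\<^sup>2 + real (strength (W \<delta> t) i))"
      unfolding Suc sum_cohort_Suc
      by (intro sum.cong refl)
        (simp add: nn_strength_offspring card_offspring_W power2_eq_square field_simps)
    also have "\<dots> = (real \<delta> + 2) / 2 * S + 6 * Q"
      unfolding sum.distrib sum_distrib_left [symmetric] sum_strength_W S_def Q_def ..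
    finally show ?thesis .
  qed
  moreover have "(real \<delta> + 2) / 2 * S + 6 * Q = 6 * Q *
      ((real \<delta> + 1) * (real \<delta> + 4) * ((real \<delta> + 2)\<^sup>2 * P) / (D * ((real \<delta> + 4) * Q))
        + 1 - 2 * (real \<delta> + 2) / D)"
  proof -
    have "(real \<delta> + 1) * (real \<delta> + 4) * ((real \<delta> + 2)\<^sup>2 * P) / (D * ((real \<delta> + 4) * Q)) =
        (real \<delta> + 1) * (real \<delta> + 2)\<^sup>2 * P / (D * Q)"
      by (simp add: divide_simps)
    then show ?thesis
      unfolding S using pos by (simp add: divide_simps) algebra
  qed
  ultimately show ?thesis
    by (simp add: Suc P_def Q_def D_def power2_eq_square)
qed

section \<open>Degree classes and the return from strengths to degrees\<close>

lemma finite_cohort: "finite (cohort \<delta> m)"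
  using step.finite_verts by (simp add: cohort_def)

text \<open>By \<open>degree_W\<close> the degree is an affine function of the strength, and a
  weighted average commutes with affine maps.\<close>

lemma weighted_nn_degree_W:
  assumes "v \<in> verts (W \<delta> n)"
  shows "weighted_nn_degree (W \<delta> n) v = (nn_strength \<delta> n v + 2 * real \<delta>) / (real \<delta> + 1)"
proof -
  have deg: "real (degree (W \<delta> n) j) =
      real (strength (W \<delta> n) j) / (real \<delta> + 1) + 2 * real \<delta> / (real \<delta> + 1)"
    if "j \<in> verts (W \<delta> n)" for j
  proof -
    have "(real \<delta> + 1) * real (degree (W \<delta> n) j) = real (strength (W \<delta> n) j) + 2 * real \<delta>"
      using arg_cong [OF degree_W [OF that], of real] by (simp add: algebra_simps)
    moreover have "real \<delta> + 1 > 0"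
      by simp
    ultimately show ?thesis
      by (simp add: eq_divide_eq mult.commute flip: add_divide_distrib)
  qed
  have "(\<Sum>j\<in>verts (W \<delta> n). real (adj_weight (W \<delta> n) v j) * real (degree (W \<delta> n) j)) =
      neighbour_sum (W \<delta> n) (\<lambda>j. real (strength (W \<delta> n) j)) v / (real \<delta> + 1)
        + neighbour_sum (W \<delta> n) (\<lambda>_. 1) v * (2 * real \<delta> / (real \<delta> + 1))"
    by (simp add: neighbour_sum_def deg distrib_left sum.distrib sum_divide_distrib sum_distrib_right)
  then show ?thesis
    using strength_W_pos [OF assms]
    by (simp add: weighted_nn_degree_def nn_strength_def add_divide_distrib distrib_left mult.commute
        flip: strength_eq_neighbour_sum)
qed

text \<open>This identifies the base of the powers in the theorem: it is half the strength, a power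
  of \<open>\<delta> + 2\<close> whose exponent is the age.\<close>

lemma degree_W_birth:
  assumes "v \<in> verts (W \<delta> n)"
  shows "real (degree (W \<delta> n) v) * (real \<delta> + 1) / 2 - real \<delta> = (real \<delta> + 2) ^ (n - birth v)"
  using arg_cong [OF degree_W [OF assms], of real]
  by (simp add: strength_W assms algebra_simps)

text \<open>The degree fixes a power of \<open>\<delta> + 2 > 1\<close>, hence the age; conversely
  the age fixes the strength and with it the degree.\<close>

lemma verts_of_degree_W:
  assumes "v \<in> verts (W \<delta> (m + a))" "birth v = m"
  shows "verts_of_degree (W \<delta> (m + a)) (degree (W \<delta> (m + a)) v) = cohort \<delta> m"
proof -
  have "degree (W \<delta> (m + a)) w = degree (W \<delta> (m + a)) v \<longleftrightarrow> birth w = m"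
    if w: "w \<in> verts (W \<delta> (m + a))" for w
  proof
    assume "degree (W \<delta> (m + a)) w = degree (W \<delta> (m + a)) v"
    with degree_W_birth [OF w] degree_W_birth [OF assms(1)]
    have "(real \<delta> + 2) ^ (m + a - birth w) = (real \<delta> + 2) ^ a"
      by (simp add: assms(2))
    then have "m + a - birth w = a"
      by (subst (asm) power_inject_exp) auto
    with birth_le [OF w] show "birth w = m"
      by simp
  next
    assume "birth w = m"
    then have "(\<delta> + 1) * degree (W \<delta> (m + a)) w = (\<delta> + 1) * degree (W \<delta> (m + a)) v"
      unfolding degree_W [OF w] degree_W [OF assms(1)] strength_W [OF w] strength_W [OF assms(1)]
      by (simp add: assms(2))
    then show "degree (W \<delta> (m + a)) w = degree (W \<delta> (m + a)) v"
      by (subst (asm) mult_left_cancel) simp_all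
  qed
  then show ?thesis
    unfolding verts_of_degree_def cohort_eq [of \<delta> m a, symmetric] by blast
qed

text \<open>The exponent is the logarithm of \<open>y\<close> to base \<open>x\<close>, so it
  exchanges the base \<open>x\<close> for \<open>y\<close>.\<close>

lemma power_powr_ln_div_ln:
  assumes "x > 1" "y > 0"
  shows "(x ^ a) powr (ln y / ln x) = (y::real) ^ a"
proof -
  have "x powr (ln y / ln x) = y"
    using assms by (simp add: powr_def)
  then have "(x powr real a) powr (ln y / ln x) = y ^ a"
    using assms by (metis mult.commute powr_powr powr_realpow)
  with assms show ?thesis
    by (simp add: powr_realpow)
qed

theorem proposition3p8:
  fixes \<delta> n k :: nat
  assumes "\<delta> \<ge> 1"
    and "\<exists>i \<in> verts (W \<delta> n). degree (W \<delta> n) i = k"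
  shows "knn_w (W \<delta> n) k =
      ((real k * (real \<delta> + 1) / 2 - real \<delta>) powr (ln (real \<delta> + 1) / ln (real \<delta> + 2)))
        / (real \<delta> + 1)
    + 2 * (((real k * (real \<delta> + 1) / 2 - real \<delta>) powr (ln (real \<delta> + 1) / ln (real \<delta> + 2)))
            / (real \<delta> + 1) + real \<delta> ^ 2 + real \<delta> - 1)
        / (real \<delta> * (real \<delta> + 2))
    - 2 * (real \<delta> + 2)
        * ((real k * (real \<delta> + 1) / 2 - real \<delta>) powr (ln (real \<delta> + 1) / ln (real \<delta> + 2)))
        / (real \<delta> * (real \<delta> + 3) * (real \<delta> + 1))
    + (real \<delta> + 2) ^ (2 * n)
        * ((real k * (real \<delta> + 1) / 2 - real \<delta>)
             powr (ln ((real \<delta> + 4) * (real \<delta> + 1)) / ln (real \<delta> + 2) - 2))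
        / (real \<delta> * (real \<delta> + 3) * (real \<delta> + 4) powi (int n - 1))"
proof -
  obtain v where v: "v \<in> verts (W \<delta> n)" "degree (W \<delta> n) v = k"
    using assms(2) by blast
  define m where "m = birth v"
  define a where "a = n - m"
  have n: "n = m + a"
    using birth_le [OF v(1)] by (simp add: a_def m_def)
  define A where "A = (real \<delta> + 1) ^ a"
  define B where "B = (real \<delta> + 2) ^ (2 * m)"
  define C where "C = (real \<delta> + 4) ^ m"
  \<comment> \<open>\<open>M\<close> is the mean of \<open>nn_strength\<close> over the cohort at
    its birth.\<close>
  define M where "M = (real \<delta> + 1) * (real \<delta> + 4) * B / (real \<delta> * (real \<delta> + 3) * C)
      + 1 - 2 * (real \<delta> + 2) / (real \<delta> * (real \<delta> + 3))"
  have C: "C > 0"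
    by (simp add: C_def)
  \<comment> \<open>The cohort contains \<open>v\<close>, so the division by its size is a genuine
    average.\<close>
  have card: "real (card (cohort \<delta> m)) > 0"
    using v(1) finite_cohort [of \<delta> m] cohort_eq [of \<delta> m a]
    by (auto simp: card_gt_0_iff n m_def)
  have x: "real k * (real \<delta> + 1) / 2 - real \<delta> = (real \<delta> + 2) ^ a"
    using degree_W_birth [OF v(1)] by (simp add: v(2) a_def m_def)
  have p1: "((real \<delta> + 2) ^ a) powr (ln (real \<delta> + 1) / ln (real \<delta> + 2)) = A"
    by (simp add: power_powr_ln_div_ln A_def)
  \<comment> \<open>The \<open>-2\<close> in the exponent reduces
    \<open>(\<delta> + 2) ^ (2 * n)\<close> to \<open>B\<close>, and the powers of
    \<open>\<delta> + 4\<close> leave \<open>(\<delta> + 4) / C\<close>. The integer power covers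
    \<open>n = 0\<close>, where the exponent is -1.\<close>
  have p2: "(real \<delta> + 2) ^ (2 * n) * ((real \<delta> + 2) ^ a)
        powr (ln ((real \<delta> + 4) * (real \<delta> + 1)) / ln (real \<delta> + 2) - 2)
      / (real \<delta> * (real \<delta> + 3) * (real \<delta> + 4) powi (int n - 1)) =
      A * B * (real \<delta> + 4) / (real \<delta> * (real \<delta> + 3) * C)"
  proof -
    have "((real \<delta> + 2) ^ a) powr (ln ((real \<delta> + 4) * (real \<delta> + 1)) / ln (real \<delta> + 2) - 2) =
        ((real \<delta> + 4) * (real \<delta> + 1)) ^ a / ((real \<delta> + 2) ^ a)\<^sup>2"
      by (simp add: powr_diff power_powr_ln_div_ln powr_numeral)
    moreover have "(real \<delta> + 4) powi (int n - 1) = (real \<delta> + 4) ^ n / (real \<delta> + 4)"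
      by (simp add: power_int_diff)
    moreover have "(real \<delta> + 2) ^ (2 * n) = B * ((real \<delta> + 2) ^ a)\<^sup>2"
      by (simp add: B_def n power_add distrib_left mult.commute flip: power_mult)
    ultimately show ?thesis
      using C by (simp add: n A_def C_def power_add power_mult_distrib mult_ac)
  qed
  have "knn_w (W \<delta> n) k =
      (\<Sum>u\<in>cohort \<delta> m. weighted_nn_degree (W \<delta> n) u) / real (card (cohort \<delta> m))"
    using verts_of_degree_W [of v \<delta> m a, folded n] v by (simp add: knn_w_def m_def [symmetric])
  \<comment> \<open>All members undergo the same affine map during the \<open>a\<close> steps after
    birth, so the sum depends only on the mean \<open>M\<close>.\<close>
  also have "(\<Sum>u\<in>cohort \<delta> m. weighted_nn_degree (W \<delta> n) u) =
      (\<Sum>u\<in>cohort \<delta> m. A / (real \<delta> + 1) * nn_strength \<delta> m u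
        + (2 * (A - 1) / (real \<delta> * (real \<delta> + 2)) + 2 * real \<delta>) / (real \<delta> + 1))"
  proof (rule sum.cong)
    fix u
    assume "u \<in> cohort \<delta> m"
    then have u: "u \<in> verts (W \<delta> m)" "u \<in> verts (W \<delta> (m + a))"
      using verts_W_mono by (auto simp: cohort_def)
    show "weighted_nn_degree (W \<delta> n) u = A / (real \<delta> + 1) * nn_strength \<delta> m u
        + (2 * (A - 1) / (real \<delta> * (real \<delta> + 2)) + 2 * real \<delta>) / (real \<delta> + 1)"
      unfolding n weighted_nn_degree_W [OF u(2)] nn_strength_add [OF assms(1) u(1)] A_def [symmetric]
      by (simp add: add_divide_distrib)
  qed simp
  also have "\<dots> = real (card (cohort \<delta> m)) * (A / (real \<delta> + 1) * M
        + (2 * (A - 1) / (real \<delta> * (real \<delta> + 2)) + 2 * real \<delta>) / (real \<delta> + 1))"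
    unfolding sum.distrib sum_distrib_left [symmetric] sum_nn_strength_cohort [OF assms(1)]
    by (simp add: M_def B_def C_def distrib_left)
  also have "\<dots> / real (card (cohort \<delta> m)) = A / (real \<delta> + 1) * M
        + (2 * (A - 1) / (real \<delta> * (real \<delta> + 2)) + 2 * real \<delta>) / (real \<delta> + 1)"
    using card by simp
  also have "\<dots> = A / (real \<delta> + 1)
      + 2 * (A / (real \<delta> + 1) + real \<delta> ^ 2 + real \<delta> - 1) / (real \<delta> * (real \<delta> + 2))
      - 2 * (real \<delta> + 2) * A / (real \<delta> * (real \<delta> + 3) * (real \<delta> + 1))
      + A * B * (real \<delta> + 4) / (real \<delta> * (real \<delta> + 3) * C)"
  proof -
    define d where "d = real \<delta>"
    have d: "d > 0"
      using assms(1) by (simp add: d_def)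
    have "A / (d + 1) * M = A / (d + 1) - 2 * (d + 2) * A / (d * (d + 3) * (d + 1))
        + A * B * (d + 4) / (d * (d + 3) * C)"
      unfolding M_def d_def [symmetric] using d C
      by (simp add: divide_simps) (simp add: algebra_simps)
    \<comment> \<open>The identity \<open>d ^ 2 * (d + 2) - 1 = (d + 1) * (d ^ 2 + d - 1)\<close>
      produces the polynomial of the stated form.\<close>
    moreover have "(2 * (A - 1) / (d * (d + 2)) + 2 * d) / (d + 1) =
        2 * (A / (d + 1) + d ^ 2 + d - 1) / (d * (d + 2))"
      using d by (simp add: divide_simps) (simp add: algebra_simps power2_eq_square)
    ultimately show ?thesis
      unfolding d_def by simp
  qed
  finally show ?thesis
    unfolding x p1 p2 .
qed

end
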